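(* There exist a hyperconvex diversity $(X,\delta)$ whose induced metric space $(X,d)$ is a hyperconvex metric space, and a mapping $T\colon X\to X$ which is nonexpansive with respect to $d$ (i.e. $d(Tx,Ty)\le d(x,y)$ for all $x,y\in X$) but which is not nonexpansive in the sense of diversities with respect to $\delta$. That is, for such diversities, nonexpansiveness of $T\colon(X,d)\to(X,d)$ need not imply nonexpansiveness of $T\colon(X,\delta)\to(X,\delta)$.
   Context: For a set $X$, $\langle X\rangle$ denotes the set of finite subsets of $X$. A diversity is a pair $(X,\delta)$ with $\delta\colon\langle X\rangle\to\mathbb{R}$ such that (1) $\delta(A)\ge 0$ for all $A\in\langle X\rangle$, and $\delta(A)=0$ if and only if $|A|\le 1$; (2) for all $A,B,C\in\langle X\rangle$ with $B\ne\emptyset$, $\delta(A\cup C)\le\delta(A\cup B)+\delta(B\cup C)$. The induced metric on $X$ is $d(x,y)=\delta(\{x,y\})$. A diversity $(X,\delta)$ is hyperconvex if for every $r\colon\langle X\rangle\to\mathbb{R}$ with $r(\emptyset)=0$ and $\delta\left(\bigcup_{A\in\mathcal{A}}A\right)\le\sum_{A\in\mathcal{A}}r(A)$ for all finite $\mathcal{A}\subseteq\langle X\rangle$, there is $z\in X$ such that $\delta(\{z\}\cup Y)\le r(Y)$ for all finite $Y\subseteq X$. A metric space $(M,d)$ is hyperconvex if for every family $\{x_\alpha\}$ of points of $M$ and every family $\{r_\alpha\}$ of nonnegative numbers with $d(x_\alpha,x_\beta)\le r_\alpha+r_\beta$ for all $\alpha,\beta$, the closed balls $\bar B(x_\alpha,r_\alpha)$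 have a common point. A mapping $T\colon X\to X$ is nonexpansive in the sense of diversities with respect to $\delta$ if $\delta(T(A))\le\delta(A)$ for every $A\in\langle X\rangle$, where $T(A)=\{T(a)\colon a\in A\}$. *)

theory Defs
  imports "HOL-Analysis.Analysis"
begin

text \<open>
  Diversities are carried by a set \<open>X\<close>; the finite subsets of \<open>X\<close> are \<^term>\<open>Fpow X\<close>.
  The values of \<open>\<delta>\<close> outside \<^term>\<open>Fpow X\<close> are irrelevant.
\<close>

locale diversity =
  fixes X :: "'a set" and \<delta> :: "'a set \<Rightarrow> real"
  assumes nonneg: "A \<in> Fpow X \<Longrightarrow> 0 \<le> \<delta> A"
    and zero_iff: "A \<in> Fpow X \<Longrightarrow> \<delta> A = 0 \<longleftrightarrow> card A \<le> 1"
    and triangle: "\<lbrakk>A \<in> Fpow X; B \<in> Fpow X; C \<in> Fpow X; B \<noteq> {}\<rbrakk>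
      \<Longrightarrow> \<delta> (A \<union> C) \<le> \<delta> (A \<union> B) + \<delta> (B \<union> C)"

text \<open>
  The extension by 0 off \<open>X\<close> only serves the locale \<^locale>\<open>Metric_space\<close>, which asks for
  nonnegativity and symmetry on the whole type.
\<close>

definition induced_dist :: "'a set \<Rightarrow> ('a set \<Rightarrow> real) \<Rightarrow> 'a \<Rightarrow> 'a \<Rightarrow> real" where
  "induced_dist X \<delta> x y = (if x \<in> X \<and> y \<in> X then \<delta> {x, y} else 0)"

lemma Metric_space_induced_dist:
  assumes "diversity X \<delta>"
  shows "Metric_space X (induced_dist X \<delta>)"
proof -
  interpret diversity X \<delta> by fact
  show ?thesis
  proof
    show "0 \<le> induced_dist X \<delta> x y" for x y
      by (auto simp: induced_dist_def Fpow_def intro: nonneg)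
    show "induced_dist X \<delta> x y = induced_dist X \<delta> y x" for x y
      by (auto simp: induced_dist_def insert_commute)
    show "induced_dist X \<delta> x y = 0 \<longleftrightarrow> x = y" if "x \<in> X" "y \<in> X" for x y
      using that zero_iff[of "{x, y}"]
      by (cases "x = y") (auto simp: induced_dist_def Fpow_def)
    show "induced_dist X \<delta> x z \<le> induced_dist X \<delta> x y + induced_dist X \<delta> y z"
      if "x \<in> X" "y \<in> X" "z \<in> X" for x y z
      using that triangle[of "{x}" "{y}" "{z}"]
      by (auto simp: induced_dist_def Fpow_def insert_commute)
  qed
qed

definition hyperconvex_diversity :: "'a set \<Rightarrow> ('a set \<Rightarrow> real) \<Rightarrow> bool" where
  "hyperconvex_diversity X \<delta> \<longleftrightarrow> diversity X \<delta> \<and>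
    (\<forall>r :: 'a set \<Rightarrow> real.
       r {} = 0 \<and> (\<forall>\<A>. finite \<A> \<and> \<A> \<subseteq> Fpow X \<longrightarrow> \<delta> (\<Union>\<A>) \<le> (\<Sum>A\<in>\<A>. r A)) \<longrightarrow>
       (\<exists>z\<in>X. \<forall>Y\<in>Fpow X. \<delta> ({z} \<union> Y) \<le> r Y))"

text \<open>
  A family of centres and radii is given by its set \<open>F\<close> of (centre, radius) pairs; a pair that
  occurs twice in a family imposes no further condition, because \<open>d x x = 0 \<le> r + r\<close>.
\<close>

definition hyperconvex_metric :: "'a set \<Rightarrow> ('a \<Rightarrow> 'a \<Rightarrow> real) \<Rightarrow> bool" where
  "hyperconvex_metric M d \<longleftrightarrow> Metric_space M d \<and>
    (\<forall>F \<subseteq> M \<times> {0..}.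
       (\<forall>(x, r)\<in>F. \<forall>(y, s)\<in>F. d x y \<le> r + s) \<longrightarrow>
       (\<exists>z\<in>M. \<forall>(x, r)\<in>F. z \<in> Metric_space.mcball M d x r))"

definition metric_nonexpansive :: "'a set \<Rightarrow> ('a \<Rightarrow> 'a \<Rightarrow> real) \<Rightarrow> ('a \<Rightarrow> 'a) \<Rightarrow> bool" where
  "metric_nonexpansive M d T \<longleftrightarrow> (\<forall>x\<in>M. \<forall>y\<in>M. d (T x) (T y) \<le> d x y)"

definition diversity_nonexpansive :: "'a set \<Rightarrow> ('a set \<Rightarrow> real) \<Rightarrow> ('a \<Rightarrow> 'a) \<Rightarrow> bool" where
  "diversity_nonexpansive X \<delta> T \<longleftrightarrow> (\<forall>A\<in>Fpow X. \<delta> (T ` A) \<le> \<delta> A)"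

end

theory Submission
  imports Defs
begin

text \<open>
  On a tree, both the diameter and the total length of the spanned subtree are hyperconvex
  diversities with the same induced metric, but on the three tips of a tripod they differ.
  On a product of two tripods take the maximum of the diameter of the first projection and the
  length of the second one: moving the first coordinate to the second
  preserves distances of the first factor but raises the diversity of the tips from 2 to 3.
  A tripod is encoded by three nonnegative coordinates of which at most one is nonzero, so that the
  length of a subtree is the sum of the coordinate ranges.
\<close>

section \<open>Coordinate ranges and the length of a finite set\<close>

definition hi :: "(nat \<Rightarrow> real) set \<Rightarrow> nat \<Rightarrow> real" where
  "hi A i = Max ((\<lambda>x. x i) ` A)"

definition lo :: "(nat \<Rightarrow> real) set \<Rightarrow> nat \<Rightarrow> real" where
  "lo A i = Min ((\<lambda>x. x i) ` A)"

text \<open>\<open>Max\<close> and \<open>Min\<close> of the empty set are unspecified, hence the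
  separate value 0. On nonempty finite subsets of the tripod each summand is the part of the spanned
  subtree on one leg.\<close>

definition len :: "(nat \<Rightarrow> real) set \<Rightarrow> real" where
  "len A = (if A = {} then 0 else \<Sum>i<3. hi A i - lo A i)"

lemma hi_singleton [simp]: "hi {x} i = x i"
  by (simp add: hi_def)

lemma lo_singleton [simp]: "lo {x} i = x i"
  by (simp add: lo_def)

lemma hi_Un: "\<lbrakk>finite A; finite B; A \<noteq> {}; B \<noteq> {}\<rbrakk> \<Longrightarrow> hi (A \<union> B) i = max (hi A i) (hi B i)"
  by (simp add: hi_def image_Un Max_Un)

lemma lo_Un: "\<lbrakk>finite A; finite B; A \<noteq> {}; B \<noteq> {}\<rbrakk> \<Longrightarrow> lo (A \<union> B) i = min (lo A i) (lo B i)"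
  by (simp add: lo_def image_Un Min_Un)

lemma le_hi: "\<lbrakk>finite A; x \<in> A\<rbrakk> \<Longrightarrow> x i \<le> hi A i"
  by (simp add: hi_def)

lemma lo_le: "\<lbrakk>finite A; x \<in> A\<rbrakk> \<Longrightarrow> lo A i \<le> x i"
  by (simp add: lo_def)

lemma hi_attained: "\<lbrakk>finite A; A \<noteq> {}\<rbrakk> \<Longrightarrow> \<exists>x\<in>A. hi A i = x i"
  unfolding hi_def using Max_in[of "(\<lambda>x. x i) ` A"] by blast

lemma lo_attained: "\<lbrakk>finite A; A \<noteq> {}\<rbrakk> \<Longrightarrow> \<exists>x\<in>A. lo A i = x i"
  unfolding lo_def using Min_in[of "(\<lambda>x. x i) ` A"] by blast

lemma lo_le_hi: "\<lbrakk>finite A; A \<noteq> {}\<rbrakk> \<Longrightarrow> lo A i \<le> hi A i"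
  using hi_attained lo_le by metis

lemma len_Un:
  "\<lbrakk>finite A; finite B; A \<noteq> {}; B \<noteq> {}\<rbrakk> \<Longrightarrow>
    len (A \<union> B) = (\<Sum>i<3. max (hi A i) (hi B i) - min (lo A i) (lo B i))"
  by (simp add: len_def hi_Un lo_Un)

lemma len_empty [simp]: "len {} = 0"
  by (simp add: len_def)

lemma len_singleton [simp]: "len {x} = 0"
  by (simp add: len_def)

lemma len_nonneg: "finite A \<Longrightarrow> 0 \<le> len A"
  by (cases "A = {}") (simp_all add: len_def lo_le_hi sum_nonneg)

lemma len_mono:
  assumes "finite B" "A \<subseteq> B"
  shows "len A \<le> len B"
proof (cases "A = {}")
  case True
  then show ?thesis using len_nonneg assms by simp
next
  case False
  have fA: "finite A" using assms finite_subset by blast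
  have "hi A i \<le> hi B i" "lo B i \<le> lo A i" for i
    using hi_attained[OF fA False, of i] lo_attained[OF fA False, of i]
      le_hi[OF assms(1)] lo_le[OF assms(1)] assms(2) by (metis subsetD)+
  then show ?thesis
    using False assms by (auto simp: len_def intro!: sum_mono diff_mono)
qed

lemma len_pair: "len {x, y} = (\<Sum>i<3. \<bar>x i - y i\<bar>)"
  using len_Un[of "{x}" "{y}"] by (simp add: insert_commute max_def min_def abs_if)
    (intro sum.cong, auto)

text \<open>A point of \<open>B\<close> lies in both \<open>A \<union> B\<close> and
  \<open>B \<union> C\<close>, so in each coordinate the two ranges overlap and their union is no
  longer than their sum.\<close>

lemma len_triangle:
  assumes "finite A" "finite B" "finite C" "B \<noteq> {}"
  shows "len (A \<union> C) \<le> len (A \<union> B) + len (B \<union> C)"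
proof -
  obtain b where b: "b \<in> B" using assms by blast
  have "len (A \<union> C) \<le> len ((A \<union> B) \<union> (B \<union> C))"
    using assms by (intro len_mono) auto
  also have "\<dots> = (\<Sum>i<3. max (hi (A \<union> B) i) (hi (B \<union> C) i) - min (lo (A \<union> B) i) (lo (B \<union> C) i))"
    using assms by (intro len_Un) auto
  also have "\<dots> \<le> (\<Sum>i<3. (hi (A \<union> B) i - lo (A \<union> B) i) + (hi (B \<union> C) i - lo (B \<union> C) i))"
  proof (rule sum_mono)
    fix i
    have "lo (A \<union> B) i \<le> b i" "b i \<le> hi (A \<union> B) i" "lo (B \<union> C) i \<le> b i" "b i \<le> hi (B \<union> C) i"
      using b assms by (auto intro: lo_le le_hi)
    then show "max (hi (A \<union> B) i) (hi (B \<union> C) i) - min (lo (A \<union> B) i) (lo (B \<union> C) i)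
      \<le> (hi (A \<union> B) i - lo (A \<union> B) i) + (hi (B \<union> C) i - lo (B \<union> C) i)" by linarith
  qed
  also have "\<dots> = len (A \<union> B) + len (B \<union> C)"
    using assms by (simp add: len_def sum.distrib)
  finally show ?thesis .
qed

section \<open>The tripod and the Helly property of its balls\<close>

text \<open>The legs are half-lines and the zero function is the centre. Coordinates from 3 on
  vanish because \<open>len\<close> does not see them and has to separate points.\<close>

definition tripod :: "(nat \<Rightarrow> real) set" where
  "tripod = {x. (\<forall>i. 0 \<le> x i) \<and> (\<forall>i\<ge>3. x i = 0) \<and> (\<forall>i j. i \<noteq> j \<longrightarrow> x i = 0 \<or> x j = 0)}"

lemma zero_in_tripod [simp]: "(\<lambda>i. 0) \<in> tripod"
  by (simp add: tripod_def)

lemma tripod_pair_eqI: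
  assumes "x \<in> tripod" "y \<in> tripod" "len {x, y} = 0"
  shows "x = y"
proof
  fix i
  have "\<forall>i<3. x i = y i"
    using assms(3) by (auto simp: len_pair sum_nonneg_eq_0_iff)
  then show "x i = y i"
    using assms(1,2) by (cases "i < 3") (auto simp: tripod_def)
qed

lemma tripod_lo_nonneg: "\<lbrakk>finite A; A \<noteq> {}; A \<subseteq> tripod\<rbrakk> \<Longrightarrow> 0 \<le> lo A i"
  using lo_attained[of A i] by (force simp: tripod_def)

text \<open>A positive \<open>lo A k\<close> puts all of \<open>A\<close> on the open leg
  \<open>k\<close>, where the other coordinates vanish.\<close>

lemma tripod_lo_hi:
  assumes "finite A" "A \<noteq> {}" "A \<subseteq> tripod" "i \<noteq> k"
  shows "lo A k = 0 \<or> hi A i = 0"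
proof -
  obtain x where x: "x \<in> A" "hi A i = x i" using hi_attained assms by blast
  then have "x i = 0 \<or> x k = 0" using assms by (auto simp: tripod_def)
  then show ?thesis
    using x lo_le[OF assms(1) x(1), of k] tripod_lo_nonneg[OF assms(1-3), of k] by auto
qed

text \<open>Off coordinate \<open>k\<close> the set \<open>B\<close> contributes only zeros, so the
  range of the union there is from 0 to \<open>hi A i\<close>.\<close>

lemma len_Un_leg:
  assumes A: "finite A" "A \<noteq> {}" "A \<subseteq> tripod" and B: "finite B" "B \<noteq> {}" "B \<subseteq> tripod"
    and k: "k < 3" and leg: "\<And>i. i \<noteq> k \<Longrightarrow> hi B i = 0"
  shows "len (A \<union> B) = max (hi A k) (hi B k) - min (lo A k) (lo B k) + (\<Sum>i\<in>{..<3}-{k}. hi A i)"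
proof -
  have "max (hi A i) (hi B i) - min (lo A i) (lo B i) = hi A i" if "i \<noteq> k" for i
    using leg[OF that] tripod_lo_nonneg[OF A, of i] tripod_lo_nonneg[OF B, of i]
      lo_le_hi[OF A(1,2), of i] lo_le_hi[OF B(1,2), of i] by auto
  then show ?thesis
    using k by (simp add: len_Un[OF A(1) B(1) A(2) B(2)] sum.remove[of "{..<3}" k])
qed

text \<open>
  The tripod is a tree, so the balls \<open>{z. len ({z} \<union> Y) \<le> r}\<close> are subtrees and have the
  Helly property. The witness is the centre unless some ball lies inside an open leg \<open>k\<close>; then it
  is the point of that leg closest to the centre which is no closer than any of these balls.
\<close>

lemma tripod_Helly:
  fixes Y :: "'i \<Rightarrow> (nat \<Rightarrow> real) set" and r :: "'i \<Rightarrow> real"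
  assumes fin: "\<And>j. j \<in> I \<Longrightarrow> finite (Y j)" and ne: "\<And>j. j \<in> I \<Longrightarrow> Y j \<noteq> {}"
    and sub: "\<And>j. j \<in> I \<Longrightarrow> Y j \<subseteq> tripod"
    and single: "\<And>j. j \<in> I \<Longrightarrow> len (Y j) \<le> r j"
    and pair: "\<And>j j'. \<lbrakk>j \<in> I; j' \<in> I\<rbrakk> \<Longrightarrow> len (Y j \<union> Y j') \<le> r j + r j'"
  shows "\<exists>z\<in>tripod. \<forall>j\<in>I. len ({z} \<union> Y j) \<le> r j"
proof (cases "\<exists>k<3. \<exists>j\<in>I. lo (Y j) k > r j - len (Y j)")
  \<comment> \<open>Adding the centre to \<open>Y j\<close> lengthens it by
    \<open>lo (Y j) k\<close> when this is positive, so the inequality says that ball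
    \<open>j\<close> misses the centre.\<close>
  case True
  then obtain k j0 where k: "k < 3" and j0: "j0 \<in> I" "lo (Y j0) k > r j0 - len (Y j0)" by blast
  define P where "P = {j\<in>I. lo (Y j) k > 0}"
  \<comment> \<open>The slack \<open>r j - len (Y j)\<close> is how far ball \<open>j\<close>
    reaches from \<open>Y j\<close> towards the centre; \<open>t\<close> is the supremum of these
    inner ends.\<close>
  define t where "t = (SUP j\<in>P. lo (Y j) k - (r j - len (Y j)))"
  \<comment> \<open>Outer bound of ball \<open>j\<close> on leg \<open>k\<close>: a point at height
    \<open>s \<ge> hi (Y j) k\<close> of the leg is in the ball iff
    \<open>s \<le> U j\<close>.\<close>
  define U where "U j = r j + lo (Y j) k - (\<Sum>i\<in>{..<3}-{k}. hi (Y j) i)" for j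
  have len_split: "len (Y j) = hi (Y j) k - lo (Y j) k + (\<Sum>i\<in>{..<3}-{k}. hi (Y j) i - lo (Y j) i)"
    if "j \<in> I" for j
    using k ne[OF that] by (simp add: len_def sum.remove[of "{..<3}" k])
  have leg: "hi (Y j) i = 0" if "j \<in> P" "i \<noteq> k" for i j
    using that tripod_lo_hi[of "Y j" i k] fin ne sub by (auto simp: P_def)
  have lenP: "len (Y j) = hi (Y j) k - lo (Y j) k" if "j \<in> P" for j
  proof -
    have j: "j \<in> I" using that by (simp add: P_def)
    have "lo (Y j) i = 0" if "i \<noteq> k" for i
      using leg[OF \<open>j \<in> P\<close> that] lo_le_hi[OF fin ne, of j i]
        tripod_lo_nonneg[OF fin ne sub, of j i] j by force
    then have "(\<Sum>i\<in>{..<3}-{k}. hi (Y j) i - lo (Y j) i) = 0"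
      using leg[OF that] by (intro sum.neutral) auto
    then show ?thesis using len_split[OF j] by simp
  qed
  have j0P: "j0 \<in> P"
    using j0 single by (force simp: P_def)
  \<comment> \<open>The union has length at least \<open>hi (Y j') k - lo (Y j) k\<close> plus the
    sum in \<open>U j\<close>, so \<open>pair\<close> keeps the inner end of ball \<open>j'\<close>
    within the outer bound of ball \<open>j\<close>.\<close>
  have upper: "lo (Y j') k - (r j' - len (Y j')) \<le> U j" if "j \<in> I" "j' \<in> P" for j j'
  proof -
    have j': "j' \<in> I" using that by (simp add: P_def)
    have "len (Y j \<union> Y j') = max (hi (Y j) k) (hi (Y j') k) - min (lo (Y j) k) (lo (Y j') k)
        + (\<Sum>i\<in>{..<3}-{k}. hi (Y j) i)"
      using that j' k leg by (intro len_Un_leg fin ne sub) auto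
    then show ?thesis
      using pair[OF that(1) j'] lenP[OF that(2)] unfolding U_def by linarith
  qed
  have bdd: "bdd_above ((\<lambda>j. lo (Y j) k - (r j - len (Y j))) ` P)"
    using upper j0(1) by (auto intro!: bdd_aboveI2)
  have t_ge: "lo (Y j) k - (r j - len (Y j)) \<le> t" if "j \<in> P" for j
    unfolding t_def using that bdd by (rule cSUP_upper)
  have t_le: "t \<le> U j" if "j \<in> I" for j
    unfolding t_def using j0P upper that by (intro cSUP_least) auto
  have t_pos: "t > 0" using t_ge[OF j0P] j0 by simp
  define z where "z = (\<lambda>i. if i = k then t else 0)"
  have z: "z \<in> tripod" using t_pos k by (auto simp: z_def tripod_def)
  have "len ({z} \<union> Y j) \<le> r j" if j: "j \<in> I" for j
  proof -
    have lenz: "len ({z} \<union> Y j) = max (hi (Y j) k) t - min (lo (Y j) k) t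
        + (\<Sum>i\<in>{..<3}-{k}. hi (Y j) i)"
      using len_Un_leg[OF fin[OF j] ne[OF j] sub[OF j], of "{z}" k] z k
      by (simp add: z_def)
    have lh: "0 \<le> lo (Y j) k" "lo (Y j) k \<le> hi (Y j) k"
      by (auto intro!: tripod_lo_nonneg lo_le_hi fin[OF j] ne[OF j] sub[OF j])
    show ?thesis
    \<comment> \<open>Beyond \<open>hi (Y j) k\<close> the bound \<open>t \<le> U j\<close>
      suffices. Otherwise \<open>z\<close> adds at most the gap from \<open>t\<close> up to
      \<open>lo (Y j) k\<close>, which the slack covers.\<close>
    proof (cases "t > hi (Y j) k")
      case True
      then show ?thesis using lenz t_le[OF j] lh by (simp add: U_def)
    next
      case False
      have "lo (Y j) i = 0" if "i \<noteq> k" for i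
        using tripod_lo_hi[OF fin ne sub, of j k i] j that False t_pos by auto
      then have l: "len (Y j) = hi (Y j) k - lo (Y j) k + (\<Sum>i\<in>{..<3}-{k}. hi (Y j) i)"
        using len_split[OF j] by simp
      have "lo (Y j) k - (r j - len (Y j)) \<le> t"
        using t_ge[of j] lh(1) j t_pos single[OF j] by (cases "j \<in> P") (auto simp: P_def)
      then show ?thesis
        using lenz l False single[OF j] by linarith
    qed
  qed
  then show ?thesis using z by blast
next
  case False
  have "len ({\<lambda>i. 0} \<union> Y j) \<le> r j" if j: "j \<in> I" for j
  proof -
    note Yj = fin[OF j] ne[OF j] sub[OF j]
    have lo0: "0 \<le> lo (Y j) i" for i by (rule tripod_lo_nonneg[OF Yj])
    have hi0: "0 \<le> hi (Y j) i" for i using lo0 lo_le_hi[OF Yj(1,2)] order_trans by blast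
    have "len ({\<lambda>i. 0} \<union> Y j) = (\<Sum>i<3. hi (Y j) i)"
      using lo0 hi0 by (subst len_Un) (auto simp: Yj)
    also have "\<dots> = len (Y j) + (\<Sum>i<3. lo (Y j) i)"
      using Yj(2) by (simp add: len_def sum_subtractf)
    finally have e: "len ({\<lambda>i. 0} \<union> Y j) = len (Y j) + (\<Sum>i<3. lo (Y j) i)" .
    show ?thesis
    \<comment> \<open>At most one minimum is nonzero, so the centre adds a single
      \<open>lo (Y j) k\<close>, bounded by the slack in this outer case.\<close>
    proof (cases "\<exists>k<3. lo (Y j) k \<noteq> 0")
      case True
      then obtain k where k: "k < 3" "lo (Y j) k \<noteq> 0" by blast
      have "lo (Y j) i = 0" if "i \<noteq> k" for i
        using tripod_lo_hi[OF Yj that] k(2) lo0[of i] lo_le_hi[OF Yj(1,2), of i] by force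
      then have "(\<Sum>i<3. lo (Y j) i) = lo (Y j) k"
        using k by (simp add: sum.remove[of "{..<3}" k])
      moreover have "lo (Y j) k \<le> r j - len (Y j)" using False k(1) j by force
      ultimately show ?thesis using e by linarith
    next
      case False
      then show ?thesis using e single[OF j] by simp
    qed
  qed
  then show ?thesis using zero_in_tripod by blast
qed

section \<open>The diameter diversity\<close>

text \<open>The inserted 0 makes the diameter of the empty set 0.\<close>

definition diam :: "(nat \<Rightarrow> real) set \<Rightarrow> real" where
  "diam A = Max (insert 0 ((\<lambda>(x, y). len {x, y}) ` (A \<times> A)))"

lemma diam_le_iff:
  assumes "finite A" "0 \<le> c"
  shows "diam A \<le> c \<longleftrightarrow> (\<forall>x\<in>A. \<forall>y\<in>A. len {x, y} \<le> c)"
  using assms by (auto simp: diam_def)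

lemma diam_nonneg: "finite A \<Longrightarrow> 0 \<le> diam A"
  by (simp add: diam_def)

lemma len_le_diam: "\<lbrakk>finite A; x \<in> A; y \<in> A\<rbrakk> \<Longrightarrow> len {x, y} \<le> diam A"
  using diam_le_iff diam_nonneg by blast

lemma diam_pair: "diam {x, y} = len {x, y}"
  by (simp add: diam_def insert_commute len_nonneg)

text \<open>The case that matters is a pair with one point in \<open>A\<close> and one in
  \<open>C\<close>, joined through a point of \<open>B\<close>.\<close>

lemma diam_triangle:
  assumes "finite A" "finite B" "finite C" "B \<noteq> {}"
  shows "diam (A \<union> C) \<le> diam (A \<union> B) + diam (B \<union> C)"
proof -
  obtain b where b: "b \<in> B" using assms by blast
  let ?c = "diam (A \<union> B) + diam (B \<union> C)"
  have nn: "0 \<le> diam (A \<union> B)" "0 \<le> diam (B \<union> C)" using assms by (auto intro: diam_nonneg)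
  have AB: "len {x, y} \<le> diam (A \<union> B)" if "x \<in> A \<union> B" "y \<in> A \<union> B" for x y
    using that assms by (intro len_le_diam) auto
  have BC: "len {x, y} \<le> diam (B \<union> C)" if "x \<in> B \<union> C" "y \<in> B \<union> C" for x y
    using that assms by (intro len_le_diam) auto
  have AC: "len {x, y} \<le> ?c" if "x \<in> A" "y \<in> C" for x y
  proof -
    have "len {x, y} \<le> len {x, b} + len {b, y}"
      using len_triangle[of "{x}" "{b}" "{y}"] by (simp add: insert_commute)
    then show ?thesis using AB[of x b] BC[of b y] that b by auto
  qed
  have "len {x, y} \<le> ?c" if xy: "x \<in> A \<union> C" "y \<in> A \<union> C" for x y
  proof -
    consider "x \<in> A" "y \<in> A" | "x \<in> C" "y \<in> C" | "x \<in> A" "y \<in> C" | "x \<in> C" "y \<in> A"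
      using xy by blast
    then show ?thesis
    proof cases
      case 1 then show ?thesis using AB[of x y] nn by auto
    next
      case 2 then show ?thesis using BC[of x y] nn by auto
    next
      case 3 then show ?thesis by (rule AC)
    next
      case 4 then show ?thesis using AC[of y x] by (simp add: insert_commute)
    qed
  qed
  then show ?thesis using assms nn by (subst diam_le_iff) auto
qed

section \<open>The product of two tripods\<close>

definition evens :: "(nat \<Rightarrow> real) \<Rightarrow> nat \<Rightarrow> real" where
  "evens x i = x (2 * i)"

definition odds :: "(nat \<Rightarrow> real) \<Rightarrow> nat \<Rightarrow> real" where
  "odds x i = x (2 * i + 1)"

text \<open>Inverse to the pair \<open>evens\<close>, \<open>odds\<close>: it codes a pair of
  sequences as one sequence, which keeps the product in the same type.\<close>

definition merge :: "(nat \<Rightarrow> real) \<Rightarrow> (nat \<Rightarrow> real) \<Rightarrow> nat \<Rightarrow> real" where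
  "merge u v n = (if even n then u (n div 2) else v (n div 2))"

lemma evens_merge [simp]: "evens (merge u v) = u"
  by (auto simp: evens_def merge_def)

lemma odds_merge [simp]: "odds (merge u v) = v"
  by (auto simp: odds_def merge_def)

lemma merge_evens_odds [simp]: "merge (evens x) (odds x) = x"
  by (auto simp: evens_def odds_def merge_def)

definition bitripod :: "(nat \<Rightarrow> real) set" where
  "bitripod = {x. evens x \<in> tripod \<and> odds x \<in> tripod}"

definition bidiv :: "(nat \<Rightarrow> real) set \<Rightarrow> real" where
  "bidiv A = max (diam (evens ` A)) (len (odds ` A))"

text \<open>Diameter and length agree on two-point sets, so the induced metric is the max metric on
  two copies of the same tree.\<close>

lemma bidiv_pair: "bidiv {x, y} = max (len {evens x, evens y}) (len {odds x, odds y})"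
  by (simp add: bidiv_def diam_pair)

lemma diversity_bidiv: "diversity bitripod bidiv"
proof
  fix A assume A: "A \<in> Fpow bitripod"
  then have fin: "finite A" by (simp add: Fpow_def)
  show nn: "0 \<le> bidiv A" using fin by (simp add: bidiv_def diam_nonneg le_max_iff_disj)
  show "bidiv A = 0 \<longleftrightarrow> card A \<le> 1"
  proof
    assume 0: "bidiv A = 0"
    have "x = y" if xy: "x \<in> A" "y \<in> A" for x y
    proof -
      have "len {evens x, evens y} \<le> bidiv A"
        using len_le_diam[of "evens ` A" "evens x" "evens y"] xy fin by (simp add: bidiv_def)
      moreover have "len {odds x, odds y} \<le> bidiv A"
        using len_mono[of "odds ` A" "{odds x, odds y}"] xy fin by (simp add: bidiv_def)
      ultimately have "len {evens x, evens y} = 0" "len {odds x, odds y} = 0"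
        using 0 len_nonneg by (auto intro!: antisym)
      then have "evens x = evens y" "odds x = odds y"
        using tripod_pair_eqI xy A by (auto simp: Fpow_def bitripod_def subset_iff)
      then show ?thesis by (metis merge_evens_odds)
    qed
    then show "card A \<le> 1" using fin by (simp add: card_le_Suc0_iff_eq)
  next
    assume "card A \<le> 1"
    then consider "A = {}" | x where "A = {x}"
      using fin by (metis card_0_eq card_1_singletonE le_neq_implies_less less_one)
    then show "bidiv A = 0"
      by cases (auto simp: bidiv_def diam_def)
  qed
next
  fix A B C assume "A \<in> Fpow bitripod" "B \<in> Fpow bitripod" "C \<in> Fpow bitripod" "B \<noteq> {}"
  then have "diam (evens ` A \<union> evens ` C) \<le> diam (evens ` A \<union> evens ` B) + diam (evens ` B \<union> evens ` C)"
    "len (odds ` A \<union> odds ` C) \<le> len (odds ` A \<union> odds ` B) + len (odds ` B \<union> odds ` C)"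
    by (auto intro!: diam_triangle len_triangle simp: Fpow_def)
  then show "bidiv (A \<union> C) \<le> bidiv (A \<union> B) + bidiv (B \<union> C)"
    unfolding bidiv_def image_Un by linarith
qed

section \<open>Hyperconvexity of the diversity and of its metric\<close>

text \<open>A maximum is at most \<open>r A\<close> iff both parts are, so the two coordinates of
  the witness come from separate uses of \<open>tripod_Helly\<close>. The hypothesis enters through
  families of one or two sets.\<close>

lemma hyperconvex_diversity_bidiv: "hyperconvex_diversity bitripod bidiv"
  unfolding hyperconvex_diversity_def
proof (intro conjI allI impI diversity_bidiv)
  interpret diversity bitripod bidiv by (rule diversity_bidiv)
  fix r :: "(nat \<Rightarrow> real) set \<Rightarrow> real"
  assume "r {} = 0 \<and> (\<forall>\<A>. finite \<A> \<and> \<A> \<subseteq> Fpow bitripod \<longrightarrow> bidiv (\<Union>\<A>) \<le> (\<Sum>A\<in>\<A>. r A))"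
  then have r0: "r {} = 0"
    and r: "\<And>\<A>. finite \<A> \<Longrightarrow> \<A> \<subseteq> Fpow bitripod \<Longrightarrow> bidiv (\<Union>\<A>) \<le> (\<Sum>A\<in>\<A>. r A)" by auto
  have r1: "bidiv A \<le> r A" if "A \<in> Fpow bitripod" for A
    using r[of "{A}"] that by simp
  have rpos: "0 \<le> r A" if "A \<in> Fpow bitripod" for A
    using r1[OF that] nonneg[OF that] by simp
  have r2: "bidiv (A \<union> B) \<le> r A + r B" if "A \<in> Fpow bitripod" "B \<in> Fpow bitripod" for A B
  proof (cases "A = B")
    \<comment> \<open>Here \<open>{A, B}\<close> has one member and its sum counts
      \<open>r A\<close> only once.\<close>
    case True
    then show ?thesis using r1[OF that(1)] rpos[OF that(1)] by simp
  next
    case False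
    then show ?thesis using r[of "{A, B}"] that by simp
  qed
  \<comment> \<open>A diameter bound constrains pairs of points, so this factor needs balls about
    single points: one of radius \<open>r A\<close> for each \<open>(A, x)\<close> with
    \<open>x \<in> A\<close>.\<close>
  have "\<exists>u\<in>tripod. \<forall>j\<in>(SIGMA A:Fpow bitripod. A). len ({u} \<union> {evens (snd j)}) \<le> r (fst j)"
  proof (rule tripod_Helly)
    fix j j' assume j: "j \<in> (SIGMA A:Fpow bitripod. A)" "j' \<in> (SIGMA A:Fpow bitripod. A)"
    then have "len {evens (snd j), evens (snd j')} \<le> diam (evens ` (fst j \<union> fst j'))"
      by (intro len_le_diam) (auto simp: Fpow_def)
    then show "len ({evens (snd j)} \<union> {evens (snd j')}) \<le> r (fst j) + r (fst j')"
      using r2[of "fst j" "fst j'"] j by (auto simp: bidiv_def insert_commute)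
  qed (use rpos in \<open>auto simp: Fpow_def bitripod_def\<close>)
  then obtain u where u1: "u \<in> tripod"
    and u': "\<forall>j\<in>(SIGMA A:Fpow bitripod. A). len ({u} \<union> {evens (snd j)}) \<le> r (fst j)" by blast
  have u2: "len {u, evens x} \<le> r A" if "A \<in> Fpow bitripod" "x \<in> A" for A x
    using bspec[OF u', of "(A, x)"] that by (simp add: insert_commute)
  note u = u1 u2
  \<comment> \<open>For the length the sets stay whole. \<open>tripod_Helly\<close> asks for
    nonempty sets; the empty one is settled below by \<open>r {} = 0\<close>.\<close>
  have "\<exists>v\<in>tripod. \<forall>A\<in>Fpow bitripod - {{}}. len ({v} \<union> odds ` A) \<le> r A"
  proof (rule tripod_Helly)
    fix A B assume "A \<in> Fpow bitripod - {{}}" "B \<in> Fpow bitripod - {{}}"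
    then show "len (odds ` A \<union> odds ` B) \<le> r A + r B"
      using r2[of A B] by (simp add: bidiv_def image_Un)
  next
    fix A assume "A \<in> Fpow bitripod - {{}}"
    then show "len (odds ` A) \<le> r A" using r1[of A] by (simp add: bidiv_def)
  qed (auto simp: Fpow_def bitripod_def)
  then obtain v where v: "v \<in> tripod"
    "\<And>A. A \<in> Fpow bitripod \<Longrightarrow> A \<noteq> {} \<Longrightarrow> len ({v} \<union> odds ` A) \<le> r A" by auto
  show "\<exists>z\<in>bitripod. \<forall>A\<in>Fpow bitripod. bidiv ({z} \<union> A) \<le> r A"
  proof (intro bexI ballI)
    show "merge u v \<in> bitripod" using u(1) v(1) by (simp add: bitripod_def)
    fix A assume A: "A \<in> Fpow bitripod"
    then have fin: "finite A" by (simp add: Fpow_def)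
    have "len {x, y} \<le> r A" if "x \<in> evens ` A" "y \<in> evens ` A" for x y
      using that len_le_diam[of "evens ` A" x y] fin r1[OF A] by (simp add: bidiv_def)
    then have "diam ({u} \<union> evens ` A) \<le> r A"
      using u(2)[OF A] rpos[OF A] fin by (subst diam_le_iff) (auto simp: insert_commute)
    moreover have "len ({v} \<union> odds ` A) \<le> r A"
      using v(2)[OF A] r0 by (cases "A = {}") auto
    ultimately show "bidiv ({merge u v} \<union> A) \<le> r A"
      by (simp add: bidiv_def image_Un)
  qed
qed

text \<open>Closed balls of the max metric are products of balls; in each factor
  \<open>tripod_Helly\<close> applies to singletons, whose length is 0.\<close>

lemma hyperconvex_metric_bidiv: "hyperconvex_metric bitripod (induced_dist bitripod bidiv)"
  unfolding hyperconvex_metric_def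
proof (intro conjI allI impI)
  show M: "Metric_space bitripod (induced_dist bitripod bidiv)"
    by (rule Metric_space_induced_dist[OF diversity_bidiv])
  fix F :: "((nat \<Rightarrow> real) \<times> real) set"
  assume F: "F \<subseteq> bitripod \<times> {0..}"
    and dF: "\<forall>(x, r)\<in>F. \<forall>(y, s)\<in>F. induced_dist bitripod bidiv x y \<le> r + s"
  have d: "len {evens (fst j), evens (fst j')} \<le> snd j + snd j'"
    "len {odds (fst j), odds (fst j')} \<le> snd j + snd j'" if "j \<in> F" "j' \<in> F" for j j'
  proof -
    have "induced_dist bitripod bidiv (fst j) (fst j') \<le> snd j + snd j'"
      using dF that by (simp add: case_prod_beta)
    moreover have "fst j \<in> bitripod" "fst j' \<in> bitripod" using F that by auto
    ultimately show "len {evens (fst j), evens (fst j')} \<le> snd j + snd j'"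
      "len {odds (fst j), odds (fst j')} \<le> snd j + snd j'"
      by (simp_all add: induced_dist_def bidiv_pair)
  qed
  have "\<exists>u\<in>tripod. \<forall>j\<in>F. len ({u} \<union> {evens (fst j)}) \<le> snd j"
    using F d by (intro tripod_Helly) (auto simp: bitripod_def insert_commute)
  then obtain u where u: "u \<in> tripod" "\<And>j. j \<in> F \<Longrightarrow> len {evens (fst j), u} \<le> snd j"
    by (auto simp: insert_commute)
  have "\<exists>v\<in>tripod. \<forall>j\<in>F. len ({v} \<union> {odds (fst j)}) \<le> snd j"
    using F d by (intro tripod_Helly) (auto simp: bitripod_def insert_commute)
  then obtain v where v: "v \<in> tripod" "\<And>j. j \<in> F \<Longrightarrow> len {odds (fst j), v} \<le> snd j"
    by (auto simp: insert_commute)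
  show "\<exists>z\<in>bitripod. \<forall>(x, r)\<in>F. z \<in> Metric_space.mcball bitripod (induced_dist bitripod bidiv) x r"
  proof (intro bexI)
    show z: "merge u v \<in> bitripod" using u(1) v(1) by (simp add: bitripod_def)
    show "\<forall>(x, r)\<in>F. merge u v \<in> Metric_space.mcball bitripod (induced_dist bitripod bidiv) x r"
      using F z u(2) v(2) by (force simp: Metric_space.in_mcball[OF M] induced_dist_def bidiv_pair)
  qed
qed

section \<open>The map that separates the two notions\<close>

definition shift_tripod :: "(nat \<Rightarrow> real) \<Rightarrow> nat \<Rightarrow> real" where
  "shift_tripod x = merge (\<lambda>i. 0) (evens x)"

lemma shift_tripod_in: "x \<in> bitripod \<Longrightarrow> shift_tripod x \<in> bitripod"
  by (auto simp: bitripod_def shift_tripod_def)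

text \<open>Images share the centre as first coordinate, and their second coordinates are as far
  apart as the first ones were.\<close>

lemma metric_nonexpansive_shift_tripod:
  "metric_nonexpansive bitripod (induced_dist bitripod bidiv) shift_tripod"
  using len_nonneg
  by (auto simp: metric_nonexpansive_def induced_dist_def shift_tripod_in bidiv_pair
      shift_tripod_def le_max_iff_disj)

lemma not_diversity_nonexpansive_shift_tripod:
  "\<not> diversity_nonexpansive bitripod bidiv shift_tripod"
proof
  assume T: "diversity_nonexpansive bitripod bidiv shift_tripod"
  define e :: "nat \<Rightarrow> nat \<Rightarrow> real" where "e k i = (if i = k then 1 else 0)" for k i
  \<comment> \<open>The unit points of the three legs have pairwise distance 2 but span a subtree of
    length 3.\<close>
  define tips where "tips = e ` {..<3}"
  define A where "A = (\<lambda>x. merge x (\<lambda>i. 0)) ` tips"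
  have tips: "tips \<subseteq> tripod" "finite tips" "tips \<noteq> {}"
    by (auto simp: tips_def tripod_def e_def lessThan_empty_iff bot_nat_def)
  have "A \<in> Fpow bitripod"
    using tips by (auto simp: A_def Fpow_def bitripod_def)
  then have le: "bidiv (shift_tripod ` A) \<le> bidiv A"
    using T by (simp add: diversity_nonexpansive_def)
  have ev: "evens ` A = tips" by (simp add: A_def image_image)
  have "odds ` A = {\<lambda>i. 0}" using tips by (auto simp: A_def image_image)
  moreover have "diam tips \<le> 2"
    using tips by (subst diam_le_iff) (auto simp: tips_def len_pair e_def numeral_3_eq_3)
  ultimately have "bidiv A \<le> 2" by (simp add: bidiv_def ev)
  have "odds ` shift_tripod ` A = tips"
    using ev by (simp add: image_image shift_tripod_def)
  then have "len tips \<le> bidiv (shift_tripod ` A)" by (simp add: bidiv_def)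
  moreover have "(1::real) \<le> hi tips i - lo tips i" if "i < 3" for i
  proof -
    have "1 \<le> hi tips i" using le_hi[of tips "e i" i] tips that by (auto simp: tips_def e_def)
    moreover have "lo tips i \<le> 0"
      \<comment> \<open>Any tip other than \<open>e i\<close> has coordinate \<open>i\<close> equal
        to 0; the \<open>if\<close> selects one.\<close>
      using lo_le[of tips "e (if i = 0 then 1 else 0)" i] tips that
      by (auto simp: tips_def e_def split: if_splits)
    ultimately show ?thesis by simp
  qed
  then have "3 \<le> len tips"
    using sum_mono[of "{..<3}" "\<lambda>i. 1" "\<lambda>i. hi tips i - lo tips i"] tips by (simp add: len_def)
  ultimately show False using le \<open>bidiv A \<le> 2\<close> by simp
qed

theorem theorem2p19:
  shows "\<exists>(X :: (nat \<Rightarrow> real) set) (\<delta> :: (nat \<Rightarrow> real) set \<Rightarrow> real) (T :: (nat \<Rightarrow> real) \<Rightarrow> (nat \<Rightarrow> real)).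
    hyperconvex_diversity X \<delta> \<and>
    hyperconvex_metric X (induced_dist X \<delta>) \<and>
    T \<in> X \<rightarrow> X \<and>
    metric_nonexpansive X (induced_dist X \<delta>) T \<and>
    \<not> diversity_nonexpansive X \<delta> T"
  using hyperconvex_diversity_bidiv hyperconvex_metric_bidiv shift_tripod_in
    metric_nonexpansive_shift_tripod not_diversity_nonexpansive_shift_tripod by blast

end
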